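(* Let $(a_i)_{i\ge1}$ and $(b_j)_{j\ge1}$ be (finite or infinite) strictly increasing sequences of positive integers, and let $\mu,\mu'$ be probability measures on $\mathbb Z$ with supports $S_\mu=\{a_i\}_{i\ge1}$ and $S_{\mu'}=\{-b_j\}_{j\ge1}$. Put $a_0=b_0=0$. Then for every $0\le r<\delta$: (i) If $D=+\infty$, then $\mathcal I_{\mathbf C}^-(r)=\mathcal I^-(r)$. (ii) If $D'=-\infty$, then $\mathcal I_{\mathbf C}^+(r)=\mathcal I^+(r)$. (iii) If $-D'<+\infty$ and $D=+\infty$, then $\mathcal I_{\mathbf C}^+(r)=\mathcal I^+(r)$ if and only if $\sup_{k\ge1}\{a_k-a_{k-1}\}\le -D'$. (iv) If $D'=-\infty$ and $D<+\infty$, then $\mathcal I_{\mathbf C}^-(r)=\mathcal I^-(r)$ if and only if $\sup_{\ell\ge1}\{b_\ell-b_{\ell-1}\}\le D$. (v) If $D<+\infty$ and $-D'<+\infty$, with $D=a_m$ and $D'=-b_n$ for some $m,n\ge1$, then $\mathcal I_{\mathbf C}^+(r)=\mathcal I^+(r)$ if and only if $\max_{1\le k\le m}\{a_k-a_{k-1}\}\le -D'$, and $\mathcal I_{\mathbf C}^-(r)=\mathcal I^-(r)$ if and only if $\max_{1\le\ell\le n}\{b_\ell-b_{\ell-1}\}\le D$. (vi) Suppose $D<+\infty$ and $-D'<+\infty$, with $D=a_m$, $D'=-b_n$, and that at least one of the two inequalities in (v) fails. Set $I^+=\{1\le k\le m: a_k-a_{k-1}>-D'\}$ and $I^-=\{1\le\ell\le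 n: b_\ell-b_{\ell-1}>D\}$. For $k\in I^+$ and $\ell\in I^-$ define $$\mathcal N_k^+(r)=\Big\{a_{k-1}+r+\delta s:\ 0\le s\le \frac{a_k-a_{k-1}+D'}{\delta}-1\Big\},$$ $$\mathcal N_\ell^-(r)=\Big\{-b_{\ell-1}+r+\delta s:\ \frac{b_{\ell-1}-b_\ell+D}{\delta}\le s\le-1\Big\},$$ with $s\in\mathbb Z$. Then $\mathcal N(r)=\bigcup_{k\in I^+}\mathcal N_k^+(r)\cup\bigcup_{\ell\in I^-}\mathcal N_\ell^-(r)$ is the set of non-crossing points, i.e. $\mathcal N(r)=\mathcal I(r)\setminus\mathcal I_{\mathbf C}(r)$.
   Context: $D=\max S_\mu$ ($=+\infty$ if $S_\mu$ is unbounded), $D'=\min S_{\mu'}$ ($=-\infty$ if $S_{\mu'}$ is unbounded), $d=\gcd(S_\mu)$, $d'=\gcd(S_{\mu'})$, $\delta=\gcd(d,d')$. The oscillating random walk $\mathcal X^{(0)}=(X_n^{(0)})_{n\ge0}$ is the Markov chain on $\mathbb Z$ with $X_{n+1}^{(0)}=X_n^{(0)}+\xi_{n+1}$ if $X_n^{(0)}\le-1$ and $X_{n+1}^{(0)}=X_n^{(0)}+\xi'_{n+1}$ if $X_n^{(0)}\ge0$, where $(\xi_n,\xi_n')_{n\ge1}$ is i.i.d., $\xi_n$ has law $\mu$ and $\xi'_n$ has law $\mu'$. For $0\le r<\delta$, $\mathcal I(r)$ is the irreducible (communicating) class of $r$ for this chain; explicitly it is the set of integers $y\equiv r\pmod\delta$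 with $D'\le y\le D-1$ (a bound being void when infinite). Put $\mathcal I^+(r)=\{y\in\mathcal I(r):y\ge0\}$ and $\mathcal I^-(r)=\{y\in\mathcal I(r):y\le-1\}$, and $$\mathcal I_{\mathbf C}^+(r)=\{y\in\mathcal I^+(r):(y-S_\mu)\cap\mathcal I^-(r)\ne\emptyset\},\qquad \mathcal I_{\mathbf C}^-(r)=\{y\in\mathcal I^-(r):(y-S_{\mu'})\cap\mathcal I^+(r)\ne\emptyset\},$$ $\mathcal I_{\mathbf C}(r)=\mathcal I_{\mathbf C}^+(r)\cup\mathcal I_{\mathbf C}^-(r)$. Points of $\mathcal I(r)$ that cannot be reached in a single step from a point of $\mathcal I(r)$ of opposite sign (with $0$ counted on the nonnegative side) are called non-crossing. *)

theory Defs
  imports "HOL-Probability.Probability"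
begin

text \<open>Probability measures on the integers are \<^typ>\<open>int pmf\<close>; their support is \<^const>\<open>set_pmf\<close>.\<close>

definition osc_D :: "int pmf \<Rightarrow> ereal" where
  "osc_D \<mu> = (if bdd_above (set_pmf \<mu>)
     then ereal (of_int (GREATEST x. x \<in> set_pmf \<mu>)) else \<infinity>)"

definition osc_D' :: "int pmf \<Rightarrow> ereal" where
  "osc_D' \<mu>' = (if bdd_below (set_pmf \<mu>')
     then ereal (of_int (LEAST x. x \<in> set_pmf \<mu>')) else - \<infinity>)"

definition osc_delta :: "int pmf \<Rightarrow> int pmf \<Rightarrow> int" where
  "osc_delta \<mu> \<mu>' = gcd (Gcd (set_pmf \<mu>)) (Gcd (set_pmf \<mu>'))"

text \<open>The oscillating random walk, given by its transition kernel and the law of its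
  position after \<open>n\<close> steps when started at \<open>x\<close>. Each step uses only one of the two increments
  \<open>\<xi>\<close>, \<open>\<xi>'\<close>, so their joint law plays no role.\<close>

definition osc_step :: "int pmf \<Rightarrow> int pmf \<Rightarrow> int \<Rightarrow> int pmf" where
  "osc_step \<mu> \<mu>' x = map_pmf (\<lambda>k. x + k) (if x \<le> -1 then \<mu> else \<mu>')"

primrec osc_law :: "int pmf \<Rightarrow> int pmf \<Rightarrow> nat \<Rightarrow> int \<Rightarrow> int pmf" where
  "osc_law \<mu> \<mu>' 0 x = return_pmf x"
| "osc_law \<mu> \<mu>' (Suc n) x = bind_pmf (osc_law \<mu> \<mu>' n x) (osc_step \<mu> \<mu>')"

definition osc_leads :: "int pmf \<Rightarrow> int pmf \<Rightarrow> int \<Rightarrow> int \<Rightarrow> bool" where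
  "osc_leads \<mu> \<mu>' x y \<longleftrightarrow> (\<exists>n. pmf (osc_law \<mu> \<mu>' n x) y > 0)"

text \<open>The communicating class of \<open>r\<close>. In the situation of interest this is the set of
  \<open>y\<close> congruent to \<open>r\<close> modulo \<open>\<delta>\<close> with \<open>D' \<le> y \<le> D - 1\<close>; that is a fact to be proved,
  not the definition.\<close>

definition osc_class :: "int pmf \<Rightarrow> int pmf \<Rightarrow> int \<Rightarrow> int set" where
  "osc_class \<mu> \<mu>' r = {y. osc_leads \<mu> \<mu>' r y \<and> osc_leads \<mu> \<mu>' y r}"

definition class_pos :: "int pmf \<Rightarrow> int pmf \<Rightarrow> int \<Rightarrow> int set" where
  "class_pos \<mu> \<mu>' r = {y \<in> osc_class \<mu> \<mu>' r. y \<ge> 0}"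

definition class_neg :: "int pmf \<Rightarrow> int pmf \<Rightarrow> int \<Rightarrow> int set" where
  "class_neg \<mu> \<mu>' r = {y \<in> osc_class \<mu> \<mu>' r. y \<le> -1}"

definition cross_pos :: "int pmf \<Rightarrow> int pmf \<Rightarrow> int \<Rightarrow> int set" where
  "cross_pos \<mu> \<mu>' r =
     {y \<in> class_pos \<mu> \<mu>' r. (\<lambda>k. y - k) ` set_pmf \<mu> \<inter> class_neg \<mu> \<mu>' r \<noteq> {}}"

definition cross_neg :: "int pmf \<Rightarrow> int pmf \<Rightarrow> int \<Rightarrow> int set" where
  "cross_neg \<mu> \<mu>' r =
     {y \<in> class_neg \<mu> \<mu>' r. (\<lambda>k. y - k) ` set_pmf \<mu>' \<inter> class_pos \<mu> \<mu>' r \<noteq> {}}"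

definition cross_class :: "int pmf \<Rightarrow> int pmf \<Rightarrow> int \<Rightarrow> int set" where
  "cross_class \<mu> \<mu>' r = cross_pos \<mu> \<mu>' r \<union> cross_neg \<mu> \<mu>' r"

definition non_crossing :: "int pmf \<Rightarrow> int pmf \<Rightarrow> int \<Rightarrow> int set" where
  "non_crossing \<mu> \<mu>' r = {y \<in> osc_class \<mu> \<mu>' r.
     \<not> (\<exists>x \<in> osc_class \<mu> \<mu>' r. (x \<ge> 0) \<noteq> (y \<ge> 0) \<and> pmf (osc_step \<mu> \<mu>' x) y > 0)}"

text \<open>A finite or infinite sequence \<open>(a\<^sub>i)\<close>, \<open>i \<ge> 1\<close>, is a function on \<^typ>\<open>nat\<close> together with a
  length \<open>L\<close>, possibly \<open>\<infinity>\<close>; only the values at indices in \<open>seq_idx L\<close> (and the value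
  at \<open>0\<close>, by convention \<open>0\<close>) are meaningful.\<close>

definition seq_idx :: "enat \<Rightarrow> nat set" where
  "seq_idx L = {i. 1 \<le> i \<and> enat i \<le> L}"

definition gap :: "(nat \<Rightarrow> int) \<Rightarrow> nat \<Rightarrow> int" where
  "gap a k = a k - a (k - 1)"

definition N_pos :: "int pmf \<Rightarrow> int pmf \<Rightarrow> (nat \<Rightarrow> int) \<Rightarrow> nat \<Rightarrow> int \<Rightarrow> int set" where
  "N_pos \<mu> \<mu>' a k r = {a (k - 1) + r + osc_delta \<mu> \<mu>' * s | s :: int.
     0 \<le> s \<and>
     ereal (of_int s) \<le>
       (ereal (of_int (a k - a (k - 1))) + osc_D' \<mu>') / ereal (of_int (osc_delta \<mu> \<mu>')) - 1}"

definition N_neg :: "int pmf \<Rightarrow> int pmf \<Rightarrow> (nat \<Rightarrow> int) \<Rightarrow> nat \<Rightarrow> int \<Rightarrow> int set" where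
  "N_neg \<mu> \<mu>' b l r = {- b (l - 1) + r + osc_delta \<mu> \<mu>' * s | s :: int.
     (ereal (of_int (b (l - 1) - b l)) + osc_D \<mu>) / ereal (of_int (osc_delta \<mu> \<mu>'))
       \<le> ereal (of_int s) \<and>
     s \<le> -1}"

end

theory Submission imports Defs
begin

text \<open>The class of \<open>r\<close> consists of the \<open>y\<close> congruent to \<open>r\<close> modulo \<open>\<delta>\<close> with
  \<open>D' \<le> y < D\<close>: restricted to two increments \<open>p\<close> and \<open>- q\<close> the walk is a rotation of
  \<open>{- q..<p}\<close>, hence invertible, and the remaining increments between \<open>- q\<close> and \<open>p\<close> enlarge the
  group of realisable shifts to the multiples of \<open>\<delta>\<close>. A point \<open>y \<ge> 0\<close> of the class is then
  non-crossing iff no \<open>a\<^sub>i\<close> lies in the window between \<open>y + 1\<close> and \<open>y - D'\<close>, that is, iff \<open>y\<close> lies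
  in a gap \<open>a\<^sub>k - a\<^sub>k\<^sub>-\<^sub>1\<close> at distance more than \<open>- D'\<close> from its right end; everything here is
  a multiple of \<open>\<delta>\<close> except for the offset \<open>r\<close>. Negative points follow by reflection.\<close>

section \<open>Divisibility and subgroups of the integers\<close>

text \<open>A finite subset with least nonzero gcd works: adding an element of \<open>A\<close>
  yields a divisor of that gcd which is not smaller, hence equal, so the gcd divides all of
  \<open>A\<close>. Infinite supports can thus be handled inside bounded windows.\<close>

lemma Gcd_eq_Gcd_finite_subset:
  fixes A :: "int set"
  shows "\<exists>F \<subseteq> A. finite F \<and> Gcd F = Gcd A"
proof (cases "A \<subseteq> {0}")
  case True
  then have "finite A" by (rule finite_subset) simp
  then show ?thesis by blast
next
  case False
  then obtain a where a: "a \<in> A" "a \<noteq> 0" by auto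
  \<comment> \<open>Gcd 0 is excluded, since otherwise the empty set would be minimal.\<close>
  let ?P = "\<lambda>F. F \<subseteq> A \<and> finite F \<and> Gcd F \<noteq> 0"
  have "?P {a}" using a by simp
  then obtain F where F: "?P F" and le: "\<And>G. ?P G \<Longrightarrow> nat (Gcd F) \<le> nat (Gcd G)"
    using ex_has_least_nat[of ?P "{a}" "\<lambda>F. nat (Gcd F)"] by metis
  have "Gcd F dvd x" if "x \<in> A" for x
  proof -
    have "?P (insert x F)" using F that by auto
    from le[OF this] have "Gcd F \<le> gcd x (Gcd F)"
      using F by (simp add: nat_le_eq_zle)
    moreover have "0 < Gcd F" using F by (simp add: less_le)
    then have "gcd x (Gcd F) \<le> Gcd F" by (intro zdvd_imp_le) auto
    ultimately have "gcd x (Gcd F) = Gcd F" by simp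
    then show ?thesis by (metis gcd_dvd1)
  qed
  then have "Gcd F dvd Gcd A" by (rule Gcd_greatest)
  moreover have "Gcd A dvd Gcd F"
    using F by (intro Gcd_greatest Gcd_dvd) auto
  ultimately have "Gcd F = Gcd A" by (intro zdvd_antisym_nonneg) auto
  then show ?thesis using F by blast
qed

lemma int_subgroup_mult_closed:
  fixes H :: "int set"
  assumes "0 \<in> H" "\<forall>x\<in>H. \<forall>y\<in>H. x + y \<in> H" "\<forall>x\<in>H. - x \<in> H"
    and "x \<in> H"
  shows "z * x \<in> H"
proof -
  have nat: "int n * x \<in> H" for n
  proof (induction n)
    case 0
    then show ?case using assms(1) by simp
  next
    case (Suc n)
    have "int (Suc n) * x = x + int n * x" by (simp add: algebra_simps)
    then show ?case using assms(2,4) Suc by simp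
  qed
  show ?thesis
  proof (cases z rule: int_cases2)
    case (nonneg n)
    with nat show ?thesis by simp
  next
    case (nonpos n)
    with assms(3) nat[of n] show ?thesis by simp
  qed
qed

lemma int_subgroup_Gcd_closed:
  fixes H :: "int set"
  assumes "0 \<in> H" "\<forall>x\<in>H. \<forall>y\<in>H. x + y \<in> H" "\<forall>x\<in>H. - x \<in> H"
    and "finite F" "F \<subseteq> H"
  shows "Gcd F \<in> H"
  using assms(4,5)
proof (induction F)
  case empty
  then show ?case using assms(1) by simp
next
  case (insert x F)
  obtain u v where "u * x + v * Gcd F = gcd x (Gcd F)" by (metis bezout_int)
  moreover have "u * x \<in> H" "v * Gcd F \<in> H"
    using insert int_subgroup_mult_closed[OF assms(1-3)] by blast+
  ultimately show ?case using assms(2) by (metis Gcd_insert)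
qed

section \<open>Reachability in the support graph\<close>

text \<open>The graph of the steps of positive probability; reachability depends on the two supports
  only.\<close>

definition osc_rel :: "int set \<Rightarrow> int set \<Rightarrow> (int \<times> int) set" where
  "osc_rel S S' = {(x, y). y - x \<in> (if x \<le> -1 then S else S')}"

text \<open>A walk that uses only the increments \<open>p\<close> and \<open>- q\<close> is the rotation by \<open>p\<close> of the integers
  modulo \<open>p + q\<close>, represented by \<open>{- q..<p}\<close>. Hence the shifts modulo \<open>p + q\<close> that the walk
  can realise from every point of this window form a group.\<close>

lemma osc_rel_leads_window:
  assumes pos: "\<forall>k\<in>S. k > 0" and neg: "\<forall>k\<in>S'. k < 0"
    and p: "p \<in> S" and q: "- q \<in> S'"
    and x: "x \<in> {- q..<p}" and y: "y \<in> {- q..<p}"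
    and dvd: "gcd (Gcd {k \<in> S. k \<le> p}) (Gcd {k \<in> S'. - q \<le> k}) dvd y - x"
  shows "(x, y) \<in> (osc_rel S S')\<^sup>*"
proof -
  let ?R = "osc_rel S S'"
  define N where "N = p + q"
  \<comment> \<open>\<open>\<rho> c\<close> is the representative of \<open>c\<close> modulo
    \<open>N\<close> in the window \<open>{- q..<p}\<close>.\<close>
  define \<rho> where "\<rho> c = (c + q) mod N - q" for c
  have p0: "p > 0" and q0: "q > 0" using pos p neg q by auto
  then have N0: "N > 0" by (simp add: N_def)
  have \<rho>_range: "- q \<le> \<rho> c" "\<rho> c < p" for c
    using pos_mod_sign[OF N0, of "c + q"] pos_mod_bound[OF N0, of "c + q"]
    unfolding \<rho>_def N_def by linarith+
  have \<rho>_eq: "\<rho> c = z" if "- q \<le> z" "z < p" "N dvd c - z" for c z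
  proof -
    have "(c + q) mod N = (z + q) mod N"
      using that(3) by (simp add: mod_eq_dvd_iff)
    also have "\<dots> = z + q"
      using that(1,2) by (intro mod_pos_pos_trivial) (auto simp: N_def)
    finally show ?thesis by (simp add: \<rho>_def)
  qed
  have \<rho>_dvd: "N dvd c - \<rho> c" for c
    unfolding \<rho>_def by (metis add_diff_eq diff_diff_eq2 dvd_minus_mod)
  have \<rho>_cong: "\<rho> c = \<rho> c'" if "N dvd c - c'" for c c'
    using that \<rho>_range \<rho>_dvd[of c'] by (intro \<rho>_eq) (auto dest: dvd_add)
  \<comment> \<open>Asking for the shift from every \<open>c\<close>, not just from one point, is
    what makes \<open>H\<close> closed under addition.\<close>
  define H where "H = {k. \<forall>c. (\<rho> c, \<rho> (c + k)) \<in> ?R\<^sup>*}"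
  have H0: "0 \<in> H" by (simp add: H_def)
  have H_add: "k + l \<in> H" if "k \<in> H" "l \<in> H" for k l
    using that unfolding H_def by (auto simp: add.assoc[symmetric] intro: rtrancl_trans)
  have H_neg: "- k \<in> H" if "k \<in> H" for k
  proof -
    have nat: "int n * k \<in> H" for n
    proof (induction n)
      case 0
      then show ?case using H0 by simp
    next
      case (Suc n)
      have "int (Suc n) * k = k + int n * k" by (simp add: algebra_simps)
      then show ?case using H_add[OF that Suc] by simp
    qed
    \<comment> \<open>Modulo \<open>N\<close> the inverse of \<open>k\<close> is the positive
      multiple \<open>(N - 1) * k\<close>, so no step has to be walked backwards.\<close>
    have "(N - 1) * k \<in> H" using nat[of "nat (N - 1)"] N0 by simp
    moreover have "\<rho> (c + (N - 1) * k) = \<rho> (c + - k)" for c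
      by (rule \<rho>_cong) (simp add: algebra_simps)
    ultimately show ?thesis by (simp add: H_def)
  qed
  have H_closed: "\<forall>x\<in>H. \<forall>y\<in>H. x + y \<in> H" "\<forall>x\<in>H. - x \<in> H"
    using H_add H_neg by blast+
  note H_mult = int_subgroup_mult_closed[OF H0 H_closed]
  note H_Gcd = int_subgroup_Gcd_closed[OF H0 H_closed]
  \<comment> \<open>A single step suffices: \<open>+ p\<close> from a negative point,
    \<open>- q\<close> from a nonnegative one, and these agree modulo
    \<open>N = p + q\<close>.\<close>
  have pH: "p \<in> H"
    unfolding H_def
  proof (intro CollectI allI)
    fix c
    have "(\<rho> c, \<rho> (c + p)) \<in> ?R"
    proof (cases "\<rho> c \<le> -1")
      case True
      then have "\<rho> (c + p) = \<rho> c + p"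
        using \<rho>_range[of c] p0 q0 \<rho>_dvd[of c] by (intro \<rho>_eq) auto
      then show ?thesis using True p by (simp add: osc_rel_def)
    next
      case False
      have "N dvd (c - \<rho> c) + N" using \<rho>_dvd by (intro dvd_add) auto
      then have "\<rho> (c + p) = \<rho> c - q"
        using False \<rho>_range[of c] p0 q0 by (intro \<rho>_eq) (auto simp: N_def algebra_simps)
      then show ?thesis using False q by (simp add: osc_rel_def)
    qed
    then show "(\<rho> c, \<rho> (c + p)) \<in> ?R\<^sup>*" by blast
  qed
  have NH: "N \<in> H"
  proof -
    have "\<rho> (c + N) = \<rho> c" for c by (rule \<rho>_cong) simp
    then show ?thesis by (simp add: H_def)
  qed
  have qH: "q \<in> H" using H_add[OF NH H_neg[OF pH]] by (simp add: N_def)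
  have posH: "k \<in> H" if k: "k \<in> S" "k \<le> p" for k
    unfolding H_def
  proof (intro CollectI allI)
    fix c
    \<comment> \<open>Shifting by \<open>- j * q\<close> brings the point into
      \<open>{- q..<0}\<close>, where increments from \<open>S\<close> apply and
      \<open>k \<le> p\<close> keeps the result in the window. After the step \<open>k\<close>, the
      shift \<open>j * q\<close> undoes the detour.\<close>
    define j where "j = \<rho> c div q + 1"
    define c' where "c' = c + - j * q"
    have "\<rho> c - j * q = \<rho> c mod q - q"
      unfolding j_def by (simp add: algebra_simps minus_mult_div_eq_mod[symmetric])
    then have z: "- q \<le> \<rho> c - j * q" "\<rho> c - j * q < 0"
      using q0 pos_mod_sign[of q "\<rho> c"] pos_mod_bound[of q "\<rho> c"] by linarith+
    have "N dvd c' - (\<rho> c - j * q)" using \<rho>_dvd[of c] by (simp add: c'_def)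
    then have c': "\<rho> c' = \<rho> c - j * q" using z p0 by (intro \<rho>_eq) auto
    have "\<rho> (c' + k) = \<rho> c' + k"
      using c' z k bspec[OF pos k(1)] \<rho>_dvd[of c'] by (intro \<rho>_eq) auto
    then have "(\<rho> c', \<rho> (c' + k)) \<in> ?R" using c' z k by (simp add: osc_rel_def)
    moreover have "(\<rho> c, \<rho> c') \<in> ?R\<^sup>*"
      using H_mult[OF qH, of "- j"] unfolding H_def c'_def by blast
    moreover have "(\<rho> (c' + k), \<rho> (c' + k + j * q)) \<in> ?R\<^sup>*"
      using H_mult[OF qH, of j] unfolding H_def by blast
    moreover have "c' + k + j * q = c + k" by (simp add: c'_def)
    ultimately show "(\<rho> c, \<rho> (c + k)) \<in> ?R\<^sup>*"
      by (metis rtrancl.rtrancl_into_rtrancl rtrancl_trans)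
  qed
  have negH: "k \<in> H" if k: "k \<in> S'" "- q \<le> k" for k
    unfolding H_def
  proof (intro CollectI allI)
    fix c
    \<comment> \<open>The mirror image under \<open>x \<mapsto> -1 - x\<close>: the detour by a
      multiple of \<open>p\<close> leads into \<open>{0..<p}\<close>, where increments from
      \<open>S'\<close> apply and \<open>- q \<le> k\<close> keeps the result in the window.\<close>
    define j where "j = - ((-1 - \<rho> c) div p + 1)"
    define c' where "c' = c + - j * p"
    have "-1 - (\<rho> c - j * p) = (-1 - \<rho> c) mod p - p"
      unfolding j_def by (simp add: algebra_simps minus_mult_div_eq_mod[symmetric])
    then have z: "0 \<le> \<rho> c - j * p" "\<rho> c - j * p < p"
      using p0 pos_mod_sign[of p "-1 - \<rho> c"] pos_mod_bound[of p "-1 - \<rho> c"] by linarith+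
    have "N dvd c' - (\<rho> c - j * p)" using \<rho>_dvd[of c] by (simp add: c'_def)
    then have c': "\<rho> c' = \<rho> c - j * p" using z q0 by (intro \<rho>_eq) auto
    have "\<rho> (c' + k) = \<rho> c' + k"
      using c' z k bspec[OF neg k(1)] \<rho>_dvd[of c'] by (intro \<rho>_eq) auto
    then have "(\<rho> c', \<rho> (c' + k)) \<in> ?R" using c' z k by (simp add: osc_rel_def)
    moreover have "(\<rho> c, \<rho> c') \<in> ?R\<^sup>*"
      using H_mult[OF pH, of "- j"] unfolding H_def c'_def by blast
    moreover have "(\<rho> (c' + k), \<rho> (c' + k + j * p)) \<in> ?R\<^sup>*"
      using H_mult[OF pH, of j] unfolding H_def by blast
    moreover have "c' + k + j * p = c + k" by (simp add: c'_def)
    ultimately show "(\<rho> c, \<rho> (c + k)) \<in> ?R\<^sup>*"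
      by (metis rtrancl.rtrancl_into_rtrancl rtrancl_trans)
  qed
  let ?d = "gcd (Gcd {k \<in> S. k \<le> p}) (Gcd {k \<in> S'. - q \<le> k})"
  have "finite {k \<in> S. k \<le> p}"
    by (rule finite_subset[of _ "{0..p}"]) (use pos in auto)
  then have "Gcd {k \<in> S. k \<le> p} \<in> H"
    by (rule H_Gcd) (auto simp: posH)
  moreover have "finite {k \<in> S'. - q \<le> k}"
    by (rule finite_subset[of _ "{- q..0}"]) (use neg in auto)
  then have "Gcd {k \<in> S'. - q \<le> k} \<in> H"
    by (rule H_Gcd) (auto simp: negH)
  ultimately have "Gcd {Gcd {k \<in> S. k \<le> p}, Gcd {k \<in> S'. - q \<le> k}} \<in> H"
    by (intro H_Gcd) auto
  then have "?d \<in> H" by simp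
  moreover obtain z where "y - x = z * ?d" using dvd by (metis dvd_def mult.commute)
  ultimately have "y - x \<in> H" using H_mult by metis
  then have "(\<rho> x, \<rho> (x + (y - x))) \<in> ?R\<^sup>*" unfolding H_def by blast
  moreover have "\<rho> x = x" "\<rho> y = y" using x y by (auto intro: \<rho>_eq)
  ultimately show ?thesis by simp
qed

lemma Gcd_uminus_image: "Gcd (uminus ` A) = Gcd A" for A :: "int set"
proof (rule zdvd_antisym_nonneg)
  have "Gcd (uminus ` A) dvd x" if "x \<in> A" for x
    using Gcd_dvd[of "- x" "uminus ` A"] that by simp
  then show "Gcd (uminus ` A) dvd Gcd A" by (rule Gcd_greatest)
  show "Gcd A dvd Gcd (uminus ` A)" by (rule Gcd_greatest) auto
qed auto

text \<open>The largest element of a finite subset with the full gcd, joined with \<open>p0\<close>,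
  is such a bound. It lets a window be widened until the increments inside it have the gcd of the
  whole support.\<close>

lemma ex_bound_Gcd:
  fixes S :: "int set"
  assumes "p0 \<in> S"
  shows "\<exists>p \<in> S. p0 \<le> p \<and> Gcd {k \<in> S. k \<le> p} = Gcd S"
proof -
  obtain F where F: "F \<subseteq> S" "finite F" "Gcd F = Gcd S"
    using Gcd_eq_Gcd_finite_subset by blast
  define p where "p = Max (insert p0 F)"
  have "p \<in> insert p0 F" unfolding p_def using F by (intro Max_in) auto
  then have "p \<in> S" using F assms by auto
  have le: "k \<le> p" if "k \<in> insert p0 F" for k
    unfolding p_def using F that by (intro Max_ge) auto
  have "Gcd {k \<in> S. k \<le> p} dvd Gcd F"
    using F le by (intro Gcd_greatest Gcd_dvd) auto
  moreover have "Gcd S dvd Gcd {k \<in> S. k \<le> p}"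
    by (intro Gcd_greatest Gcd_dvd) auto
  ultimately have "Gcd {k \<in> S. k \<le> p} = Gcd S"
    using F(3) by (intro zdvd_antisym_nonneg) auto
  then show ?thesis using \<open>p \<in> S\<close> le by blast
qed

text \<open>The window is enlarged around \<open>x\<close> and \<open>y\<close> until the truncated
  supports have the gcds of the full ones; then \<open>osc_rel_leads_window\<close> applies.\<close>

lemma osc_rel_leads:
  assumes pos: "\<forall>k\<in>S. k > 0" and neg: "\<forall>k\<in>S'. k < 0"
    and p: "p \<in> S" "x < p" "y < p" and q: "q \<in> S'" "q \<le> x" "q \<le> y"
    and dvd: "gcd (Gcd S) (Gcd S') dvd y - x"
  shows "(x, y) \<in> (osc_rel S S')\<^sup>*"
proof -
  obtain p' where p': "p' \<in> S" "p \<le> p'" "Gcd {k \<in> S. k \<le> p'} = Gcd S"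
    using ex_bound_Gcd[OF p(1)] by blast
  obtain q' where q': "q' \<in> uminus ` S'" "- q \<le> q'"
      "Gcd {k \<in> uminus ` S'. k \<le> q'} = Gcd (uminus ` S')"
    using ex_bound_Gcd[of "- q" "uminus ` S'"] q(1) by blast
  have "{k \<in> uminus ` S'. k \<le> q'} = uminus ` {k \<in> S'. - q' \<le> k}" by force
  then have "Gcd {k \<in> S'. - q' \<le> k} = Gcd S'"
    using q'(3) by (simp add: Gcd_uminus_image)
  then show ?thesis
    using p p' q q' dvd by (intro osc_rel_leads_window[OF pos neg, of p' q']) auto
qed

section \<open>The communicating class\<close>

text \<open>The support of the law after \<open>n\<close> steps is the set of points reached by the
  \<open>n\<close>-fold power of the step relation.\<close>

lemma osc_leads_iff: "osc_leads \<mu> \<mu>' x y \<longleftrightarrow> (x, y) \<in> (osc_rel (set_pmf \<mu>) (set_pmf \<mu>'))\<^sup>*"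
proof -
  let ?R = "osc_rel (set_pmf \<mu>) (set_pmf \<mu>')"
  have step: "y \<in> set_pmf (osc_step \<mu> \<mu>' x) \<longleftrightarrow> (x, y) \<in> ?R" for x y
    unfolding osc_step_def osc_rel_def by (force simp: image_iff)
  have "set_pmf (osc_law \<mu> \<mu>' n x) = {y. (x, y) \<in> ?R ^^ n}" for n
    by (induction n) (auto simp: step)
  then show ?thesis
    unfolding osc_leads_def by (auto simp: pmf_positive_iff rtrancl_power)
qed

text \<open>The right-hand side contains \<open>r\<close> and is preserved by every step, and any
  two of its points are joined by \<open>osc_rel_leads\<close>. Bounds are given by witnesses
  \<open>p\<close> and \<open>q\<close>, which covers finite and infinite extremes alike.\<close>

lemma osc_class_eq:
  assumes pos: "\<forall>k\<in>set_pmf \<mu>. k > 0" and neg: "\<forall>k\<in>set_pmf \<mu>'. k < 0"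
    and r: "0 \<le> r" "r < osc_delta \<mu> \<mu>'"
  shows "osc_class \<mu> \<mu>' r =
    {y. osc_delta \<mu> \<mu>' dvd y - r \<and> (\<exists>p \<in> set_pmf \<mu>. y < p) \<and> (\<exists>q \<in> set_pmf \<mu>'. q \<le> y)}"
    (is "_ = ?C")
proof -
  let ?\<delta> = "osc_delta \<mu> \<mu>'" and ?R = "osc_rel (set_pmf \<mu>) (set_pmf \<mu>')"
  have dvd: "?\<delta> dvd k" if "k \<in> set_pmf \<mu> \<union> set_pmf \<mu>'" for k
    using that unfolding osc_delta_def by (auto intro: dvd_trans[OF _ Gcd_dvd])
  have r_less: "r < p" if "p \<in> set_pmf \<mu>" for p
    using zdvd_imp_le[of ?\<delta> p] dvd[of p] pos that r by fastforce
  have r_ge: "q \<le> r" if "q \<in> set_pmf \<mu>'" for q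
    using neg that r by fastforce
  have "y \<in> ?C" if "(r, y) \<in> ?R\<^sup>*" for y
    using that
  proof induction
    case base
    have "\<exists>p. p \<in> set_pmf \<mu>" "\<exists>q. q \<in> set_pmf \<mu>'" by (auto simp: ex_in_conv set_pmf_not_empty)
    then show ?case using r_less r_ge by auto
  next
    case (step y z)
    then obtain p q where pq: "p \<in> set_pmf \<mu>" "y < p" "q \<in> set_pmf \<mu>'" "q \<le> y" by blast
    have k: "z - y \<in> (if y \<le> -1 then set_pmf \<mu> else set_pmf \<mu>')"
      using step by (simp add: osc_rel_def)
    then have "?\<delta> dvd z - y" by (intro dvd) (auto split: if_splits)
    then have "?\<delta> dvd (z - y) + (y - r)" using step.IH by (intro dvd_add) auto
    \<comment> \<open>An upward step starts at \<open>y \<le> -1\<close>, so its increment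
      \<open>z - y\<close> itself exceeds \<open>z\<close>; a downward step keeps the old bound. The
      lower bound is dual.\<close>
    moreover have "\<exists>p \<in> set_pmf \<mu>. z < p"
    proof (cases "y \<le> -1")
      case True
      then show ?thesis using k by (intro bexI[of _ "z - y"]) auto
    next
      case False
      then have "z - y < 0" using k neg by auto
      then show ?thesis using pq by (intro bexI[of _ p]) auto
    qed
    moreover have "\<exists>q \<in> set_pmf \<mu>'. q \<le> z"
    proof (cases "y \<le> -1")
      case True
      then have "0 < z - y" using k pos by auto
      then show ?thesis using pq by (intro bexI[of _ q]) auto
    next
      case False
      then show ?thesis using k by (intro bexI[of _ "z - y"]) auto
    qed
    ultimately show ?case by simp
  qed
  moreover have "(r, y) \<in> ?R\<^sup>* \<and> (y, r) \<in> ?R\<^sup>*" if y: "y \<in> ?C" for y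
  proof -
    from y obtain p q where "p \<in> set_pmf \<mu>" "y < p" "q \<in> set_pmf \<mu>'" "q \<le> y" by blast
    moreover have "gcd (Gcd (set_pmf \<mu>)) (Gcd (set_pmf \<mu>')) dvd y - r"
      "gcd (Gcd (set_pmf \<mu>)) (Gcd (set_pmf \<mu>')) dvd r - y"
      using y by (auto simp: osc_delta_def dvd_diff_commute)
    ultimately show ?thesis
      using r_less r_ge osc_rel_leads[OF pos neg] by blast
  qed
  ultimately show ?thesis unfolding osc_class_def osc_leads_iff by blast
qed

section \<open>Points in the long gaps of an increasing sequence\<close>

lemma seq_idx_pred:
  assumes "k \<in> seq_idx L"
  shows "k - 1 = 0 \<or> k - 1 \<in> seq_idx L"
proof -
  have "enat (k - 1) \<le> enat k" by simp
  then have "enat (k - 1) \<le> L" using assms unfolding seq_idx_def by (blast intro: order_trans)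
  then show ?thesis by (auto simp: seq_idx_def)
qed

text \<open>The non-crossing points of one half-line when the largest jump back from the other side
  has size \<open>M\<close>. The generic form serves \<open>a\<close> with offset \<open>r\<close>
  and, after reflection, \<open>b\<close> with offset \<open>\<delta> - 1 - r\<close>.\<close>

definition uncrossed :: "(nat \<Rightarrow> int) \<Rightarrow> enat \<Rightarrow> int \<Rightarrow> int \<Rightarrow> int \<Rightarrow> int set" where
  "uncrossed a L d r M = {y. 0 \<le> y \<and> d dvd y - r \<and> (\<exists>i \<in> seq_idx L. y < a i) \<and>
     \<not> (\<exists>i \<in> seq_idx L. y < a i \<and> a i \<le> y + M)}"

text \<open>If no term of \<open>a\<close> lies in \<open>{y<..y + M}\<close>, then with
  \<open>k\<close> the first index such that \<open>y < a k\<close>, this whole window lies between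
  \<open>a (k - 1)\<close> and \<open>a k\<close>. The last inequality is the division-free form of
  \<open>s \<le> (gap a k - M) / d - 1\<close>.\<close>

lemma mem_uncrossed_iff:
  assumes a0: "a 0 = 0" and pos: "\<forall>i \<in> seq_idx L. a i > 0"
    and mono: "strict_mono_on (seq_idx L) a"
    and dvd: "\<forall>i \<in> seq_idx L. d dvd a i" "d dvd M" and "0 \<le> M" and r: "0 \<le> r" "r < d"
  shows "y \<in> uncrossed a L d r M \<longleftrightarrow>
    (\<exists>k \<in> seq_idx L. \<exists>s \<ge> 0. y = a (k - 1) + r + d * s \<and> d * s + d \<le> gap a k - M)"
    (is "_ \<longleftrightarrow> ?R")
proof -
  note prev = seq_idx_pred[of _ L]
  then have prev_dvd: "d dvd a (k - 1)" and prev_nonneg: "0 \<le> a (k - 1)"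
    if "k \<in> seq_idx L" for k
    using that dvd pos a0 by (metis dvd_0_right, metis less_le order_refl)
  have le: "a i \<le> a j" if "i \<in> seq_idx L" "j \<in> seq_idx L" "i \<le> j" for i j
    using strict_mono_on_leD[OF mono] that by blast
  show ?thesis
  proof
    assume ?R
    then obtain k s where k: "k \<in> seq_idx L" and s: "0 \<le> s" "y = a (k - 1) + r + d * s"
      "d * s + d \<le> gap a k - M" by blast
    have "0 \<le> d * s" using s r by simp
    then have y: "a (k - 1) \<le> y" "y + M < a k" using s r by (auto simp: gap_def)
    have "\<not> (y < a i \<and> a i \<le> y + M)" if i: "i \<in> seq_idx L" for i
    proof (cases "i < k")
      case True
      then have "k - 1 \<noteq> 0" using i by (auto simp: seq_idx_def)
      then have "a i \<le> a (k - 1)" using prev[OF k] True i by (intro le) auto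
      then show ?thesis using y by simp
    next
      case False
      then have "a k \<le> a i" using k i by (intro le) auto
      then show ?thesis using y by simp
    qed
    moreover have "d dvd y - r" using s prev_dvd[OF k] by simp
    moreover have "y < a k" using y \<open>0 \<le> M\<close> by simp
    ultimately show "y \<in> uncrossed a L d r M"
      using k y prev_nonneg[OF k] unfolding uncrossed_def by auto
  next
    assume y: "y \<in> uncrossed a L d r M"
    define k where "k = (LEAST k. k \<in> seq_idx L \<and> y < a k)"
    obtain i where "i \<in> seq_idx L \<and> y < a i" using y by (auto simp: uncrossed_def)
    then have "k \<in> seq_idx L \<and> y < a k" unfolding k_def by (rule LeastI)
    then have k: "k \<in> seq_idx L" "y < a k" by auto
    have "k - 1 < k" using k(1) by (auto simp: seq_idx_def)
    then have "\<not> (k - 1 \<in> seq_idx L \<and> y < a (k - 1))" unfolding k_def by (rule not_less_Least)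
    \<comment> \<open>For \<open>k = 1\<close> the convention \<open>a 0 = 0\<close> supplies the
      lower end of the gap.\<close>
    then have below: "a (k - 1) \<le> y" using prev[OF k(1)] a0 y by (auto simp: uncrossed_def)
    have above: "y + M < a k" using y k by (force simp: uncrossed_def)
    have "d dvd y - r" using y by (simp add: uncrossed_def)
    then have "d dvd (y - r) - a (k - 1)" using prev_dvd[OF k(1)] by (rule dvd_diff)
    then obtain s where "(y - r) - a (k - 1) = d * s" by (rule dvdE)
    then have s: "y = a (k - 1) + r + d * s" by simp
    have "0 < d" using r by simp
    \<comment> \<open>The bound \<open>a (k - 1) \<le> y\<close> gives only
      \<open>- r \<le> d * s\<close>; since \<open>r < d\<close>, this still excludes negative
      \<open>s\<close>.\<close>
    have "d * (-1) < d * s" using s below r by simp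
    then have "-1 < s" using \<open>0 < d\<close> mult_less_cancel_left_pos by blast
    then have "0 \<le> s" by simp
    have "d dvd (a k - a (k - 1)) - M"
      using dvd_diff[OF dvd_diff[OF bspec[OF dvd(1) k(1)] prev_dvd[OF k(1)]] dvd(2)] .
    then obtain t where t: "(a k - a (k - 1)) - M = d * t" by (rule dvdE)
    \<comment> \<open>Both sides are multiples of \<open>d\<close>, so the strict inequality
      improves to a difference of at least \<open>d\<close>, which absorbs the offset
      \<open>r\<close>.\<close>
    then have "d * s < d * t" using s above r by linarith
    then have "s < t" using \<open>0 < d\<close> mult_less_cancel_left_pos by blast
    then have "s + 1 \<le> t" by simp
    then have "d * (s + 1) \<le> d * t" using \<open>0 < d\<close> by (intro mult_left_mono) auto
    then have "d * s + d \<le> gap a k - M" using t by (simp add: gap_def algebra_simps)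
    then show ?R using k(1) s \<open>0 \<le> s\<close> by blast
  qed
qed

text \<open>A gap exceeding \<open>M\<close> exceeds it by at least \<open>d\<close>, as both are
  multiples of \<open>d\<close>; hence \<open>s = 0\<close> already gives the uncrossed point
  \<open>a (k - 1) + r\<close>.\<close>

lemma uncrossed_empty_iff:
  assumes "a 0 = 0" "\<forall>i \<in> seq_idx L. a i > 0" "strict_mono_on (seq_idx L) a"
    and dvd: "\<forall>i \<in> seq_idx L. d dvd a i" "d dvd M" and M: "0 \<le> M" and r: "0 \<le> r" "r < d"
  shows "uncrossed a L d r M = {} \<longleftrightarrow> (\<forall>k \<in> seq_idx L. gap a k \<le> M)"
proof -
  note mem = mem_uncrossed_iff[OF assms]
  have "gap a k \<le> M" if "uncrossed a L d r M = {}" and k: "k \<in> seq_idx L" for k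
  proof (rule ccontr)
    assume *: "\<not> gap a k \<le> M"
    have "d dvd a (k - 1)"
      using seq_idx_pred[OF k] dvd(1) assms(1) by (metis dvd_0_right)
    then have "d dvd gap a k - M" using k dvd by (auto simp: gap_def intro!: dvd_diff)
    then have "d \<le> gap a k - M" using * by (intro zdvd_imp_le) auto
    then have "a (k - 1) + r \<in> uncrossed a L d r M"
      unfolding mem using k by (intro bexI[of _ k] exI[of _ 0]) auto
    then show False using that by simp
  qed
  moreover have "\<exists>k \<in> seq_idx L. \<not> gap a k \<le> M" if y: "y \<in> uncrossed a L d r M" for y
  proof -
    obtain k s where ks: "k \<in> seq_idx L" "0 \<le> s" "d * s + d \<le> gap a k - M"
      using y unfolding mem by blast
    then have "0 \<le> d * s" using r by simp
    then have "M < gap a k" using ks(3) r by linarith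
    then show ?thesis using ks(1) by force
  qed
  ultimately show ?thesis by blast
qed

text \<open>A strictly increasing sequence cannot continue past an index where it attains its
  maximum.\<close>

lemma seq_idx_eq_atLeastAtMost:
  fixes a :: "nat \<Rightarrow> int"
  assumes "strict_mono_on (seq_idx L) a" "m \<in> seq_idx L" "\<forall>i \<in> seq_idx L. a i \<le> a m"
  shows "seq_idx L = {1..m}"
proof -
  have "i \<le> m" if "i \<in> seq_idx L" for i
    using strict_mono_onD[OF assms(1,2) that] assms(3) that by (meson leD leI)
  moreover have "i \<in> seq_idx L" if "i \<in> {1..m}" for i
    using that assms(2) order_trans[of "enat i" "enat m" L] by (auto simp: seq_idx_def)
  ultimately show ?thesis by (auto simp: seq_idx_def)
qed

section \<open>Extreme points of the supports, and non-crossing points\<close>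

lemma int_bdd_above_has_max:
  fixes A :: "int set"
  assumes "A \<noteq> {}" "bdd_above A"
  shows "\<exists>m \<in> A. \<forall>x \<in> A. x \<le> m"
proof -
  obtain u where u: "\<forall>x \<in> A. x \<le> u" using assms(2) by (auto simp: bdd_above_def)
  obtain x0 where x0: "x0 \<in> A" using assms(1) by blast
  let ?B = "{x \<in> A. x0 \<le> x}"
  have fin: "finite ?B" by (rule finite_subset[of _ "{x0..u}"]) (use u in auto)
  have "Max ?B \<in> ?B" using fin x0 by (intro Max_in) auto
  moreover have "x \<le> Max ?B" if "x \<in> A" for x
    using fin x0 that Max_ge[of ?B] by (metis (mono_tags, lifting) linear mem_Collect_eq order_trans)
  ultimately show ?thesis by blast
qed

lemma osc_D_cases:
  obtains (infinite) "osc_D \<mu> = \<infinity>" "\<And>y. \<exists>x \<in> set_pmf \<mu>. y < x"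
  | (finite) m where "osc_D \<mu> = ereal (of_int m)" "m \<in> set_pmf \<mu>" "\<forall>x \<in> set_pmf \<mu>. x \<le> m"
proof (cases "bdd_above (set_pmf \<mu>)")
  case True
  then obtain m where m: "m \<in> set_pmf \<mu>" "\<forall>x \<in> set_pmf \<mu>. x \<le> m"
    using int_bdd_above_has_max[OF set_pmf_not_empty] by blast
  then have "(GREATEST x. x \<in> set_pmf \<mu>) = m" by (intro Greatest_equality) auto
  then show ?thesis using True m by (intro finite) (auto simp: osc_D_def)
next
  case False
  then show ?thesis by (intro infinite) (auto simp: osc_D_def bdd_above_def not_le)
qed

lemma osc_D'_cases:
  obtains (infinite) "osc_D' \<mu> = - \<infinity>" "\<And>y. \<exists>x \<in> set_pmf \<mu>. x \<le> y"
  | (finite) m where "osc_D' \<mu> = ereal (of_int m)" "m \<in> set_pmf \<mu>" "\<forall>x \<in> set_pmf \<mu>. m \<le> x"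
proof (cases "bdd_below (set_pmf \<mu>)")
  case True
  have "\<exists>m \<in> uminus ` set_pmf \<mu>. \<forall>x \<in> uminus ` set_pmf \<mu>. x \<le> m"
    using True set_pmf_not_empty[of \<mu>] by (intro int_bdd_above_has_max) auto
  then obtain m where m: "m \<in> set_pmf \<mu>" "\<forall>x \<in> set_pmf \<mu>. m \<le> x" by auto
  then have "(LEAST x. x \<in> set_pmf \<mu>) = m" by (intro Least_equality) auto
  then show ?thesis using True m by (intro finite) (auto simp: osc_D'_def)
next
  case False
  then show ?thesis
    by (intro infinite) (auto simp: osc_D'_def bdd_below_def not_le intro: less_imp_le)
qed

text \<open>With \<open>x = y - k\<close>, the conditions in \<open>cross_pos\<close> and
  \<open>cross_neg\<close> say that \<open>y\<close> is reached in one step from a point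
  \<open>x\<close> of the class of opposite sign; the sign of \<open>x\<close> selects the increment
  law.\<close>

lemma non_crossing_eq: "non_crossing \<mu> \<mu>' r = osc_class \<mu> \<mu>' r - cross_class \<mu> \<mu>' r"
proof -
  have step: "pmf (osc_step \<mu> \<mu>' x) y > 0 \<longleftrightarrow>
    y - x \<in> (if x \<le> -1 then set_pmf \<mu> else set_pmf \<mu>')" for x y
    unfolding osc_step_def by (force simp: pmf_positive_iff image_iff)
  have pre: "(\<lambda>k. y - k) ` A \<inter> B \<noteq> {} \<longleftrightarrow> (\<exists>x \<in> B. y - x \<in> A)" for y :: int and A B
    by force
  have mem: "y \<in> cross_class \<mu> \<mu>' r \<longleftrightarrow> y \<in> osc_class \<mu> \<mu>' r \<and>
    (\<exists>x \<in> osc_class \<mu> \<mu>' r. (x \<ge> 0) \<noteq> (y \<ge> 0) \<and> y - x \<in> (if x \<le> -1 then set_pmf \<mu> else set_pmf \<mu>'))" for y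
  proof -
    have neg: "x \<le> -1 \<longleftrightarrow> \<not> 0 \<le> x" for x :: int by auto
    then show ?thesis
      unfolding cross_class_def cross_pos_def cross_neg_def class_pos_def class_neg_def
        Un_iff mem_Collect_eq pre neg by (cases "0 \<le> y") auto
  qed
  show ?thesis unfolding non_crossing_def step set_eq_iff Diff_iff mem by blast
qed

lemma osc_class_diff_cross_class:
  "osc_class \<mu> \<mu>' r - cross_class \<mu> \<mu>' r =
    (class_pos \<mu> \<mu>' r - cross_pos \<mu> \<mu>' r) \<union> (class_neg \<mu> \<mu>' r - cross_neg \<mu> \<mu>' r)"
  unfolding cross_class_def cross_pos_def cross_neg_def class_pos_def class_neg_def by auto

section \<open>Crossing points for supports enumerated by sequences\<close>

locale osc_walk =
  fixes \<mu> \<mu>' :: "int pmf" and a b :: "nat \<Rightarrow> int" and La Lb :: enat and r :: int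
  assumes a0: "a 0 = 0" and b0: "b 0 = 0"
    and a_pos: "\<forall>i \<in> seq_idx La. a i > 0" and b_pos: "\<forall>j \<in> seq_idx Lb. b j > 0"
    and a_mono: "strict_mono_on (seq_idx La) a" and b_mono: "strict_mono_on (seq_idx Lb) b"
    and supp: "set_pmf \<mu> = a ` seq_idx La"
    and supp': "set_pmf \<mu>' = (\<lambda>j. - b j) ` seq_idx Lb"
    and r: "0 \<le> r" "r < osc_delta \<mu> \<mu>'"
begin

abbreviation \<delta> :: int where "\<delta> \<equiv> osc_delta \<mu> \<mu>'"

lemma dvd_a: "\<forall>i \<in> seq_idx La. \<delta> dvd a i"
  unfolding osc_delta_def supp by (auto intro: dvd_trans[OF gcd_dvd1 Gcd_dvd])

lemma dvd_b: "\<forall>j \<in> seq_idx Lb. \<delta> dvd b j"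
proof
  fix j assume "j \<in> seq_idx Lb"
  then have "\<delta> dvd - b j"
    unfolding osc_delta_def supp' by (intro dvd_trans[OF gcd_dvd2 Gcd_dvd]) auto
  then show "\<delta> dvd b j" by simp
qed

lemma seq_idx_nonempty: "\<exists>i. i \<in> seq_idx La" "\<exists>j. j \<in> seq_idx Lb"
  using set_pmf_not_empty[of \<mu>] set_pmf_not_empty[of \<mu>'] unfolding supp supp' by auto

lemma mem_class: "y \<in> osc_class \<mu> \<mu>' r \<longleftrightarrow>
    \<delta> dvd y - r \<and> (\<exists>i \<in> seq_idx La. y < a i) \<and> (\<exists>j \<in> seq_idx Lb. - b j \<le> y)"
  using a_pos b_pos r by (subst osc_class_eq) (auto simp: supp supp')

lemma mem_class_pos: "y \<in> class_pos \<mu> \<mu>' r \<longleftrightarrow>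
    0 \<le> y \<and> \<delta> dvd y - r \<and> (\<exists>i \<in> seq_idx La. y < a i)"
  using seq_idx_nonempty(2) b_pos unfolding class_pos_def mem_Collect_eq mem_class
  by (meson less_imp_le neg_le_0_iff_le order_trans)

lemma mem_class_neg: "y \<in> class_neg \<mu> \<mu>' r \<longleftrightarrow>
    y \<le> -1 \<and> \<delta> dvd y - r \<and> (\<exists>j \<in> seq_idx Lb. - b j \<le> y)"
proof -
  have "y < a i" if "y \<le> -1" "i \<in> seq_idx La" for i
    using a_pos that by fastforce
  then show ?thesis
    using seq_idx_nonempty(1) unfolding class_neg_def mem_Collect_eq mem_class by blast
qed

text \<open>Since \<open>\<delta>\<close> divides \<open>a i\<close>, the predecessor
  \<open>y - a i\<close> has the right residue automatically; only its sign and its lower bound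
  remain as conditions.\<close>

lemma mem_cross_pos: "y \<in> cross_pos \<mu> \<mu>' r \<longleftrightarrow> y \<in> class_pos \<mu> \<mu>' r \<and>
    (\<exists>i \<in> seq_idx La. y < a i \<and> (\<exists>j \<in> seq_idx Lb. a i \<le> y + b j))"
proof -
  have "y - a i \<in> class_neg \<mu> \<mu>' r \<longleftrightarrow> y < a i \<and> (\<exists>j \<in> seq_idx Lb. a i \<le> y + b j)"
    if "y \<in> class_pos \<mu> \<mu>' r" "i \<in> seq_idx La" for i
  proof -
    have "\<delta> dvd y - r" using that(1) by (simp add: mem_class_pos)
    then have "\<delta> dvd (y - r) - a i" using that(2) dvd_a dvd_diff by blast
    then have "\<delta> dvd (y - a i) - r" by (simp add: algebra_simps)
    then show ?thesis unfolding mem_class_neg by (auto simp: algebra_simps simp del: dvd_diff_right_iff)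
  qed
  then show ?thesis unfolding cross_pos_def supp disjoint_iff by auto
qed

lemma mem_cross_neg: "y \<in> cross_neg \<mu> \<mu>' r \<longleftrightarrow> y \<in> class_neg \<mu> \<mu>' r \<and>
    (\<exists>j \<in> seq_idx Lb. 0 \<le> y + b j \<and> (\<exists>i \<in> seq_idx La. y + b j < a i))"
proof -
  have "y + b j \<in> class_pos \<mu> \<mu>' r \<longleftrightarrow> 0 \<le> y + b j \<and> (\<exists>i \<in> seq_idx La. y + b j < a i)"
    if "y \<in> class_neg \<mu> \<mu>' r" "j \<in> seq_idx Lb" for j
  proof -
    have "\<delta> dvd y - r" using that(1) by (simp add: mem_class_neg)
    then have "\<delta> dvd (y - r) + b j" using that(2) dvd_b by (intro dvd_add) auto
    then have "\<delta> dvd (y + b j) - r" by (simp add: algebra_simps)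
    then show ?thesis unfolding mem_class_pos by (auto simp: algebra_simps)
  qed
  then show ?thesis unfolding cross_neg_def supp' disjoint_iff by auto
qed

text \<open>Membership in the class supplies an \<open>a i\<close> above \<open>y\<close>, and some
  \<open>b j\<close> is large enough for \<open>y - a i\<close> to lie in the class.\<close>

lemma cross_pos_unbounded:
  assumes "osc_D' \<mu>' = - \<infinity>"
  shows "cross_pos \<mu> \<mu>' r = class_pos \<mu> \<mu>' r"
proof -
  have "\<exists>j \<in> seq_idx Lb. z \<le> y + b j" for y z
  proof (cases rule: osc_D'_cases[of \<mu>'])
    case infinite
    then obtain x where "x \<in> set_pmf \<mu>'" "x \<le> y - z" by blast
    then show ?thesis unfolding supp' by force
  qed (use assms in auto)
  then show ?thesis unfolding set_eq_iff mem_cross_pos by (auto simp: mem_class_pos)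
qed

text \<open>Membership in the class supplies a \<open>b j\<close> with
  \<open>0 \<le> y + b j\<close>, and some \<open>a i\<close> exceeds that point.\<close>

lemma cross_neg_unbounded:
  assumes "osc_D \<mu> = \<infinity>"
  shows "cross_neg \<mu> \<mu>' r = class_neg \<mu> \<mu>' r"
proof -
  have "\<exists>i \<in> seq_idx La. y < a i" for y
  proof (cases rule: osc_D_cases[of \<mu>])
    case infinite
    then show ?thesis unfolding supp by blast
  qed (use assms in auto)
  moreover have "0 \<le> y + b j \<longleftrightarrow> - b j \<le> y" for y j by auto
  ultimately show ?thesis unfolding set_eq_iff mem_cross_neg by (auto simp: mem_class_neg)
qed

lemma r_reflected: "0 \<le> \<delta> - 1 - r" "\<delta> - 1 - r < \<delta>"
  using r by auto

text \<open>With \<open>b n\<close> maximal, the existential over \<open>j\<close> in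
  \<open>mem_cross_pos\<close> collapses to \<open>j = n\<close>.\<close>

lemma class_pos_diff_cross_pos:
  assumes n: "n \<in> seq_idx Lb" "\<forall>j \<in> seq_idx Lb. b j \<le> b n"
  shows "class_pos \<mu> \<mu>' r - cross_pos \<mu> \<mu>' r = uncrossed a La \<delta> r (b n)"
proof -
  have "(\<exists>j \<in> seq_idx Lb. z \<le> y + b j) \<longleftrightarrow> z \<le> y + b n" for y z
    using n by (meson add_left_mono order_trans)
  then show ?thesis
    unfolding set_eq_iff Diff_iff mem_cross_pos uncrossed_def mem_Collect_eq mem_class_pos by blast
qed

text \<open>The reflection \<open>y \<mapsto> -1 - y\<close> interchanges the two half-lines and the roles of
  \<open>a\<close> and \<open>b\<close>, and sends the residue \<open>r\<close> to \<open>\<delta> - 1 - r\<close>.\<close>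

lemma class_neg_diff_cross_neg:
  assumes m: "m \<in> seq_idx La" "\<forall>i \<in> seq_idx La. a i \<le> a m"
  shows "class_neg \<mu> \<mu>' r - cross_neg \<mu> \<mu>' r =
    (\<lambda>z. -1 - z) ` uncrossed b Lb \<delta> (\<delta> - 1 - r) (a m)"
proof -
  have D: "(\<exists>i \<in> seq_idx La. y < a i) \<longleftrightarrow> y < a m" for y
    using m by (meson less_le_trans)
  \<comment> \<open>The two differences are negatives of each other up to one multiple of
    \<open>\<delta>\<close>.\<close>
  have dvd: "\<delta> dvd (-1 - y) - (\<delta> - 1 - r) \<longleftrightarrow> \<delta> dvd y - r" for y
  proof -
    have "(-1 - y) - (\<delta> - 1 - r) = - ((y - r) + \<delta> * 1)" by simp
    then show ?thesis by (metis dvd_minus_iff dvd_add_times_triv_right_iff mult.commute)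
  qed
  have lt: "-1 - y < b j \<longleftrightarrow> 0 \<le> y + b j" and ge: "b j \<le> -1 - y + a m \<longleftrightarrow> y + b j < a m"
    and lt': "- b j \<le> y \<longleftrightarrow> 0 \<le> y + b j" and nn: "0 \<le> -1 - y \<longleftrightarrow> y \<le> -1"
    for y j by auto
  have "y \<in> class_neg \<mu> \<mu>' r - cross_neg \<mu> \<mu>' r \<longleftrightarrow>
      -1 - y \<in> uncrossed b Lb \<delta> (\<delta> - 1 - r) (a m)" for y
    unfolding Diff_iff mem_cross_neg D uncrossed_def mem_Collect_eq mem_class_neg dvd lt ge nn lt'
    by blast
  moreover have "y \<in> (\<lambda>z. -1 - z) ` A \<longleftrightarrow> -1 - y \<in> A" for y :: int and A
    by force
  ultimately show ?thesis unfolding set_eq_iff by blast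
qed

lemma cross_pos_eq_iff:
  assumes n: "n \<in> seq_idx Lb" "\<forall>j \<in> seq_idx Lb. b j \<le> b n"
  shows "cross_pos \<mu> \<mu>' r = class_pos \<mu> \<mu>' r \<longleftrightarrow> (\<forall>k \<in> seq_idx La. gap a k \<le> b n)"
proof -
  have "cross_pos \<mu> \<mu>' r \<subseteq> class_pos \<mu> \<mu>' r" by (auto simp: cross_pos_def)
  then have "cross_pos \<mu> \<mu>' r = class_pos \<mu> \<mu>' r \<longleftrightarrow> uncrossed a La \<delta> r (b n) = {}"
    using class_pos_diff_cross_pos[OF n] by blast
  also have "\<dots> \<longleftrightarrow> (\<forall>k \<in> seq_idx La. gap a k \<le> b n)"
    using n b_pos dvd_b r by (intro uncrossed_empty_iff a0 a_pos a_mono dvd_a) (auto intro: less_imp_le)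
  finally show ?thesis .
qed

lemma cross_neg_eq_iff:
  assumes m: "m \<in> seq_idx La" "\<forall>i \<in> seq_idx La. a i \<le> a m"
  shows "cross_neg \<mu> \<mu>' r = class_neg \<mu> \<mu>' r \<longleftrightarrow> (\<forall>k \<in> seq_idx Lb. gap b k \<le> a m)"
proof -
  have "cross_neg \<mu> \<mu>' r \<subseteq> class_neg \<mu> \<mu>' r" by (auto simp: cross_neg_def)
  then have "cross_neg \<mu> \<mu>' r = class_neg \<mu> \<mu>' r \<longleftrightarrow> uncrossed b Lb \<delta> (\<delta> - 1 - r) (a m) = {}"
    using class_neg_diff_cross_neg[OF m] by blast
  also have "\<dots> \<longleftrightarrow> (\<forall>k \<in> seq_idx Lb. gap b k \<le> a m)"
    using m a_pos dvd_a r_reflected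
    by (intro uncrossed_empty_iff b0 b_pos b_mono dvd_b) (auto intro: less_imp_le)
  finally show ?thesis .
qed

section \<open>The explicit sets of non-crossing points\<close>

text \<open>Multiplying out the positive \<open>\<delta>\<close> turns the bound in extended reals
  into the integer form of \<open>mem_uncrossed_iff\<close>.\<close>

lemma mem_N_pos:
  assumes "osc_D' \<mu>' = ereal (of_int (- M))"
  shows "y \<in> N_pos \<mu> \<mu>' a k r \<longleftrightarrow>
    (\<exists>s \<ge> 0. y = a (k - 1) + r + \<delta> * s \<and> \<delta> * s + \<delta> \<le> gap a k - M)"
proof -
  have "0 < real_of_int \<delta>" using r by simp
  then have "ereal (of_int s) \<le>
      (ereal (of_int (a k - a (k - 1))) + osc_D' \<mu>') / ereal (of_int \<delta>) - 1 \<longleftrightarrow>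
    real_of_int (\<delta> * s + \<delta>) \<le> real_of_int (gap a k - M)" for s
    unfolding assms gap_def one_ereal_def by (simp add: field_simps)
  then show ?thesis unfolding N_pos_def of_int_le_iff by auto
qed

text \<open>The substitution \<open>s \<mapsto> -1 - s\<close> matches the reflection
  \<open>y \<mapsto> -1 - y\<close>: it turns the range \<open>s \<le> -1\<close> into
  \<open>s \<ge> 0\<close> and the offset \<open>r\<close> into
  \<open>\<delta> - 1 - r\<close>.\<close>

lemma mem_N_neg:
  assumes "osc_D \<mu> = ereal (of_int M)"
  shows "y \<in> N_neg \<mu> \<mu>' b l r \<longleftrightarrow>
    (\<exists>s \<ge> 0. -1 - y = b (l - 1) + (\<delta> - 1 - r) + \<delta> * s \<and> \<delta> * s + \<delta> \<le> gap b l - M)"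
    (is "_ \<longleftrightarrow> (\<exists>s \<ge> 0. ?P s)")
proof -
  have "0 < real_of_int \<delta>" using r by simp
  then have le: "(ereal (of_int (b (l - 1) - b l)) + osc_D \<mu>) / ereal (of_int \<delta>) \<le> ereal (of_int s) \<longleftrightarrow>
    real_of_int (- \<delta> * s) \<le> real_of_int (gap b l - M)" for s
    unfolding assms gap_def by (auto simp: field_simps)
  have "y \<in> N_neg \<mu> \<mu>' b l r \<longleftrightarrow> (\<exists>s \<le> -1. y = - b (l - 1) + r + \<delta> * s \<and> - \<delta> * s \<le> gap b l - M)"
    unfolding N_neg_def le of_int_le_iff by auto
  also have "\<dots> \<longleftrightarrow> (\<exists>s \<le> -1. ?P (-1 - s))"
    by (auto simp: algebra_simps)
  also have "\<dots> \<longleftrightarrow> (\<exists>s \<ge> 0. ?P s)"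
  proof
    assume "\<exists>s \<le> -1. ?P (-1 - s)"
    then obtain s where "s \<le> -1" "?P (-1 - s)" by blast
    then show "\<exists>s \<ge> 0. ?P s" by (intro exI[of _ "-1 - s"]) auto
  next
    assume "\<exists>s \<ge> 0. ?P s"
    then obtain s where "s \<ge> 0" "?P s" by blast
    then show "\<exists>s \<le> -1. ?P (-1 - s)" by (intro exI[of _ "-1 - s"]) auto
  qed
  finally show ?thesis .
qed

lemma gap_greater_if:
  assumes "0 \<le> s" "\<delta> * s + \<delta> \<le> g - M"
  shows "M < g"
proof -
  have "0 \<le> \<delta> * s" using assms r by simp
  then show ?thesis using assms(2) r by linarith
qed

text \<open>By \<open>gap_greater_if\<close>, an index with gap at most \<open>b n\<close>
  contributes the empty set, so the union may run over all of \<open>seq_idx La\<close>.\<close>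

lemma UN_N_pos:
  assumes n: "n \<in> seq_idx Lb" and D': "osc_D' \<mu>' = ereal (of_int (- b n))"
  shows "(\<Union>k \<in> {k \<in> seq_idx La. gap a k > b n}. N_pos \<mu> \<mu>' a k r) = uncrossed a La \<delta> r (b n)"
proof -
  have "y \<in> uncrossed a La \<delta> r (b n) \<longleftrightarrow> (\<exists>k \<in> seq_idx La. y \<in> N_pos \<mu> \<mu>' a k r)" for y
    unfolding mem_N_pos[OF D'] using n b_pos dvd_b r
    by (intro mem_uncrossed_iff a0 a_pos a_mono dvd_a) (auto intro: less_imp_le)
  moreover have "gap a k > b n" if "y \<in> N_pos \<mu> \<mu>' a k r" for y k
    using that gap_greater_if unfolding mem_N_pos[OF D'] by blast
  ultimately show ?thesis unfolding set_eq_iff by blast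
qed

lemma UN_N_neg:
  assumes m: "m \<in> seq_idx La" and D: "osc_D \<mu> = ereal (of_int (a m))"
  shows "(\<Union>l \<in> {l \<in> seq_idx Lb. gap b l > a m}. N_neg \<mu> \<mu>' b l r) =
    (\<lambda>z. -1 - z) ` uncrossed b Lb \<delta> (\<delta> - 1 - r) (a m)"
proof -
  have "-1 - y \<in> uncrossed b Lb \<delta> (\<delta> - 1 - r) (a m) \<longleftrightarrow>
      (\<exists>k \<in> seq_idx Lb. y \<in> N_neg \<mu> \<mu>' b k r)" for y
    unfolding mem_N_neg[OF D] using m a_pos dvd_a r_reflected
    by (intro mem_uncrossed_iff b0 b_pos b_mono dvd_b) (auto intro: less_imp_le)
  moreover have "gap b k > a m" if "y \<in> N_neg \<mu> \<mu>' b k r" for y k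
    using that gap_greater_if unfolding mem_N_neg[OF D] by blast
  moreover have img: "y \<in> (\<lambda>z. -1 - z) ` A \<longleftrightarrow> -1 - y \<in> A" for y :: int and A
    by force
  ultimately show ?thesis unfolding set_eq_iff img by blast
qed

section \<open>Finite extreme values and the six claims\<close>

lemma osc_D_finite:
  assumes "osc_D \<mu> \<noteq> \<infinity>"
  obtains m where "m \<in> seq_idx La" "osc_D \<mu> = ereal (of_int (a m))" "\<forall>i \<in> seq_idx La. a i \<le> a m"
  using assms by (cases rule: osc_D_cases[of \<mu>]) (auto simp: supp)

lemma osc_D'_finite:
  assumes "osc_D' \<mu>' \<noteq> - \<infinity>"
  obtains n where "n \<in> seq_idx Lb" "osc_D' \<mu>' = ereal (of_int (- b n))" "\<forall>j \<in> seq_idx Lb. b j \<le> b n"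
  using assms by (cases rule: osc_D'_cases[of \<mu>']) (auto simp: supp')

text \<open>\<open>osc_D_finite\<close> yields a maximal index, whose value must agree with
  \<open>a m\<close>.\<close>

lemma a_le_if_osc_D:
  assumes "osc_D \<mu> = ereal (of_int (a m))"
  shows "\<forall>i \<in> seq_idx La. a i \<le> a m"
  by (rule osc_D_finite) (use assms in auto)

lemma b_le_if_osc_D':
  assumes "osc_D' \<mu>' = ereal (of_int (- b n))"
  shows "\<forall>j \<in> seq_idx Lb. b j \<le> b n"
  by (rule osc_D'_finite) (use assms in auto)

end

theorem theorem3p3:
  fixes \<mu> \<mu>' :: "int pmf" and a b :: "nat \<Rightarrow> int" and La Lb :: enat and r :: int
  assumes "a 0 = 0" and "b 0 = 0"
    and "\<forall>i \<in> seq_idx La. a i > 0" and "\<forall>j \<in> seq_idx Lb. b j > 0"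
    and "strict_mono_on (seq_idx La) a" and "strict_mono_on (seq_idx Lb) b"
    and "set_pmf \<mu> = a ` seq_idx La"
    and "set_pmf \<mu>' = (\<lambda>j. - b j) ` seq_idx Lb"
    and "0 \<le> r" and "r < osc_delta \<mu> \<mu>'"
  shows
    "(osc_D \<mu> = \<infinity> \<longrightarrow> cross_neg \<mu> \<mu>' r = class_neg \<mu> \<mu>' r)
   \<and> (osc_D' \<mu>' = - \<infinity> \<longrightarrow> cross_pos \<mu> \<mu>' r = class_pos \<mu> \<mu>' r)
   \<and> (- osc_D' \<mu>' < \<infinity> \<and> osc_D \<mu> = \<infinity> \<longrightarrow>
        (cross_pos \<mu> \<mu>' r = class_pos \<mu> \<mu>' r \<longleftrightarrow>
         (SUP k \<in> seq_idx La. ereal (of_int (gap a k))) \<le> - osc_D' \<mu>'))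
   \<and> (osc_D' \<mu>' = - \<infinity> \<and> osc_D \<mu> < \<infinity> \<longrightarrow>
        (cross_neg \<mu> \<mu>' r = class_neg \<mu> \<mu>' r \<longleftrightarrow>
         (SUP l \<in> seq_idx Lb. ereal (of_int (gap b l))) \<le> osc_D \<mu>))
   \<and> (\<forall>m \<in> seq_idx La. \<forall>n \<in> seq_idx Lb.
        osc_D \<mu> < \<infinity> \<and> - osc_D' \<mu>' < \<infinity> \<and>
        osc_D \<mu> = ereal (of_int (a m)) \<and> osc_D' \<mu>' = ereal (of_int (- b n)) \<longrightarrow>
        (cross_pos \<mu> \<mu>' r = class_pos \<mu> \<mu>' r \<longleftrightarrow>
         ereal (of_int (Max (gap a ` {1..m}))) \<le> - osc_D' \<mu>')
      \<and> (cross_neg \<mu> \<mu>' r = class_neg \<mu> \<mu>' r \<longleftrightarrow>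
         ereal (of_int (Max (gap b ` {1..n}))) \<le> osc_D \<mu>))
   \<and> (\<forall>m \<in> seq_idx La. \<forall>n \<in> seq_idx Lb. \<forall>Ipos Ineg N.
        osc_D \<mu> < \<infinity> \<and> - osc_D' \<mu>' < \<infinity> \<and>
        osc_D \<mu> = ereal (of_int (a m)) \<and> osc_D' \<mu>' = ereal (of_int (- b n)) \<and>
        (\<not> ereal (of_int (Max (gap a ` {1..m}))) \<le> - osc_D' \<mu>' \<or>
         \<not> ereal (of_int (Max (gap b ` {1..n}))) \<le> osc_D \<mu>) \<and>
        Ipos = {k \<in> {1..m}. ereal (of_int (gap a k)) > - osc_D' \<mu>'} \<and>
        Ineg = {l \<in> {1..n}. ereal (of_int (gap b l)) > osc_D \<mu>} \<and>
        N = (\<Union>k \<in> Ipos. N_pos \<mu> \<mu>' a k r) \<union> (\<Union>l \<in> Ineg. N_neg \<mu> \<mu>' b l r) \<longrightarrow>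
        N = non_crossing \<mu> \<mu>' r \<and> N = osc_class \<mu> \<mu>' r - cross_class \<mu> \<mu>' r)"
proof -
  interpret osc_walk \<mu> \<mu>' a b La Lb r
    using assms by unfold_locales
  \<comment> \<open>Membership in \<open>seq_idx L\<close> gives \<open>1 \<le> m\<close>, so the
    maximum is taken over a nonempty set.\<close>
  have Max_le: "Max (gap c ` {1..m}) \<le> M \<longleftrightarrow> (\<forall>k \<in> {1..m}. gap c k \<le> M)"
    if "m \<in> seq_idx L" for c m M L
    using that by (subst Max_le_iff) (auto simp: seq_idx_def)
  have iii: "cross_pos \<mu> \<mu>' r = class_pos \<mu> \<mu>' r \<longleftrightarrow>
      (SUP k \<in> seq_idx La. ereal (of_int (gap a k))) \<le> - osc_D' \<mu>'"
    if fin: "- osc_D' \<mu>' < \<infinity>"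
  proof -
    have "osc_D' \<mu>' \<noteq> - \<infinity>" using fin by auto
    then obtain n where n: "n \<in> seq_idx Lb" "osc_D' \<mu>' = ereal (of_int (- b n))"
      "\<forall>j \<in> seq_idx Lb. b j \<le> b n" by (rule osc_D'_finite)
    show ?thesis using n(2) cross_pos_eq_iff[OF n(1,3)] by (simp add: SUP_le_iff)
  qed
  have iv: "cross_neg \<mu> \<mu>' r = class_neg \<mu> \<mu>' r \<longleftrightarrow>
      (SUP l \<in> seq_idx Lb. ereal (of_int (gap b l))) \<le> osc_D \<mu>"
    if fin: "osc_D \<mu> < \<infinity>"
  proof -
    have "osc_D \<mu> \<noteq> \<infinity>" using fin by auto
    then obtain m where m: "m \<in> seq_idx La" "osc_D \<mu> = ereal (of_int (a m))"
      "\<forall>i \<in> seq_idx La. a i \<le> a m" by (rule osc_D_finite)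
    show ?thesis using m(2) cross_neg_eq_iff[OF m(1,3)] by (simp add: SUP_le_iff)
  qed
  have v: "(cross_pos \<mu> \<mu>' r = class_pos \<mu> \<mu>' r \<longleftrightarrow>
         ereal (of_int (Max (gap a ` {1..m}))) \<le> - osc_D' \<mu>')
      \<and> (cross_neg \<mu> \<mu>' r = class_neg \<mu> \<mu>' r \<longleftrightarrow>
         ereal (of_int (Max (gap b ` {1..n}))) \<le> osc_D \<mu>)"
    if mn: "m \<in> seq_idx La" "n \<in> seq_idx Lb"
      and D: "osc_D \<mu> = ereal (of_int (a m))" "osc_D' \<mu>' = ereal (of_int (- b n))" for m n
  proof -
    note le = a_le_if_osc_D[OF D(1)] b_le_if_osc_D'[OF D(2)]
    have idx: "seq_idx La = {1..m}" "seq_idx Lb = {1..n}"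
      using seq_idx_eq_atLeastAtMost a_mono b_mono mn le by blast+
    show ?thesis
      unfolding cross_pos_eq_iff[OF mn(2) le(2)] cross_neg_eq_iff[OF mn(1) le(1)]
      using Max_le[OF mn(1), of a "b n"] Max_le[OF mn(2), of b "a m"] by (simp add: D idx)
  qed
  have vi: "(\<Union>k \<in> {k \<in> {1..m}. ereal (of_int (gap a k)) > - osc_D' \<mu>'}. N_pos \<mu> \<mu>' a k r) \<union>
        (\<Union>l \<in> {l \<in> {1..n}. ereal (of_int (gap b l)) > osc_D \<mu>}. N_neg \<mu> \<mu>' b l r) =
      osc_class \<mu> \<mu>' r - cross_class \<mu> \<mu>' r"
    if mn: "m \<in> seq_idx La" "n \<in> seq_idx Lb"
      and D: "osc_D \<mu> = ereal (of_int (a m))" "osc_D' \<mu>' = ereal (of_int (- b n))" for m n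
  proof -
    note le = a_le_if_osc_D[OF D(1)] b_le_if_osc_D'[OF D(2)]
    have idx: "seq_idx La = {1..m}" "seq_idx Lb = {1..n}"
      using seq_idx_eq_atLeastAtMost a_mono b_mono mn le by blast+
    have I: "{k \<in> {1..m}. ereal (of_int (gap a k)) > - osc_D' \<mu>'} = {k \<in> seq_idx La. gap a k > b n}"
      "{l \<in> {1..n}. ereal (of_int (gap b l)) > osc_D \<mu>} = {l \<in> seq_idx Lb. gap b l > a m}"
      by (simp_all add: D idx)
    show ?thesis
      unfolding I UN_N_pos[OF mn(2) D(2)] UN_N_neg[OF mn(1) D(1)] osc_class_diff_cross_class
        class_pos_diff_cross_pos[OF mn(2) le(2)] class_neg_diff_cross_neg[OF mn(1) le(1)] ..
  qed
  show ?thesis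
    \<comment> \<open>After this rewriting the two equations required of \<open>N\<close> coincide,
      and \<open>vi\<close> proves both.\<close>
    unfolding non_crossing_eq
    by (intro conjI ballI allI impI; (elim conjE)?;
        (rule cross_neg_unbounded cross_pos_unbounded iii iv v[THEN conjunct1] v[THEN conjunct2];
          assumption | clarify, rule vi; assumption))
qed

end
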